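(* Let $k$ be an even integer, $s$ an integer, and let $H$ be a graph on $2k-1-2s$ vertices in which every vertex has degree $k-1$ except exactly one vertex, which has degree $k-2$. Then $$\mathcal{N}(K_3,H)\le \frac{1}{6}(2k-1-2s)\Big((k-1)(k-2)-(k-1-2s)(2s+1)\Big)+\frac{1}{2}-s.$$
   Context: $\mathcal{N}(K_3,H)$ denotes the number of triangles in the graph $H$. *)

theory Defs
  imports Complex_Main "Graph_Theory.Graph_Theory"
begin

text \<open>
  Finite simple graphs are \<^locale>\<open>graph\<close>s, that is, finite, loop-free, symmetric digraphs
  without parallel arcs. An undirected edge \<open>uv\<close> is a pair of opposite arcs, so the degree of a
  vertex is its \<^const>\<open>out_degree\<close>.

  A \<^const>\<open>subgraph\<close> has the same tail and head functions as the ambient graph, so distinct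
  elements of the set below differ in vertices or arcs. The symmetry required by \<open>K\<^bsub>3\<^esub>\<close> ensures
  that each triangle is counted once, without orientation.
\<close>

definition num_triangles :: "('a, 'b) pre_digraph \<Rightarrow> nat" where
  "num_triangles H = card {T. subgraph T H \<and> K\<^bsub>3\<^esub> T}"

end

theory Submission
  imports Defs
begin

text \<open>
  Goodman's argument. For every ordered triple of distinct vertices \<open>(x, y, z)\<close>, at most one of
  the following four events occurs: \<open>xyz\<close> is a triangle, or one of the three cyclic rotations
  \<open>(u, v, w)\<close> of \<open>(x, y, z)\<close> has \<open>uv\<close> an edge and \<open>uw\<close> a non-edge. Summing over all triples
  gives \<open>6t + 3 \<Sum> d(x) (n - 1 - d(x)) \<le> n (n - 1) (n - 2)\<close>, where \<open>t\<close> is the number of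
  triangles, and the theorem is this inequality for the given degree sequence.
\<close>

text \<open>Triangles appear here as 3-element cliques of a bare relation, so that the counting
  needs only adjacency and no arcs.\<close>

definition triangle_sets :: "('a \<Rightarrow> 'a \<Rightarrow> bool) \<Rightarrow> 'a set \<Rightarrow> 'a set set" where
  "triangle_sets R V = {S. S \<subseteq> V \<and> card S = 3 \<and> (\<forall>x\<in>S. \<forall>y\<in>S. x \<noteq> y \<longrightarrow> R x y)}"

text \<open>All three variables range over the same set, so a cyclic renaming is just two exchanges
  of sums. This makes the three rotated terms in Goodman's count contribute equally.\<close>

lemma sum_rotate:
  fixes f :: "'a \<Rightarrow> 'a \<Rightarrow> 'a \<Rightarrow> int"
  shows "(\<Sum>x\<in>V. \<Sum>y\<in>V. \<Sum>z\<in>V. f y z x) = (\<Sum>x\<in>V. \<Sum>y\<in>V. \<Sum>z\<in>V. f x y z)"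
proof -
  have "(\<Sum>x\<in>V. \<Sum>y\<in>V. \<Sum>z\<in>V. f y z x) = (\<Sum>y\<in>V. \<Sum>x\<in>V. \<Sum>z\<in>V. f y z x)"
    by (rule sum.swap)
  also have "\<dots> = (\<Sum>y\<in>V. \<Sum>z\<in>V. \<Sum>x\<in>V. f y z x)"
    by (intro sum.cong refl sum.swap)
  finally show ?thesis .
qed

lemma sum_of_bool_distinct_triples:
  assumes "finite V"
  shows "(\<Sum>x\<in>V. \<Sum>y\<in>V. \<Sum>z\<in>V. of_bool (x \<noteq> y \<and> y \<noteq> z \<and> x \<noteq> z) :: int)
    = int (card V) * (int (card V) - 1) * (int (card V) - 2)"
proof -
  have z: "(\<Sum>z\<in>V. of_bool (x \<noteq> y \<and> y \<noteq> z \<and> x \<noteq> z) :: int)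
      = of_bool (x \<noteq> y) * (int (card V) - 2)" if "x \<in> V" "y \<in> V" for x y
  proof (cases "x = y")
    case False
    have "V \<inter> {z. y \<noteq> z \<and> x \<noteq> z} = V - {x, y}" by auto
    moreover have "card {x, y} \<le> card V" using that assms by (intro card_mono) auto
    ultimately show ?thesis
      using False that assms by (simp add: card_Diff_subset of_nat_diff)
  qed simp
  have y: "(\<Sum>y\<in>V. of_bool (x \<noteq> y) :: int) = int (card V) - 1" if "x \<in> V" for x
  proof -
    have "V \<inter> {y. x \<noteq> y} = V - {x}" by auto
    moreover have "card {x} \<le> card V" using that assms by (intro card_mono) auto
    ultimately show ?thesis
      using that assms by (simp add: card_Diff_subset of_nat_diff)
  qed
  show ?thesis
    by (simp add: z y flip: sum_distrib_right)
qed

text \<open>A clique contains \<open>R\<close> in both directions between any two of its points, so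
  each of its six orderings is a cyclic triple. Orderings of different cliques are different
  triples.\<close>

lemma six_mult_card_triangle_sets_le:
  assumes "finite V" and irrefl: "\<And>x. \<not> R x x"
  shows "6 * int (card (triangle_sets R V))
    \<le> (\<Sum>x\<in>V. \<Sum>y\<in>V. \<Sum>z\<in>V. of_bool (R x y \<and> R y z \<and> R z x))"
proof -
  define T where "T = triangle_sets R V"
  define P where "P = {(x, y, z) \<in> V \<times> V \<times> V. R x y \<and> R y z \<and> R z x}"
  \<comment> \<open>\<open>F S\<close> is the fibre over \<open>S\<close> of the map forgetting the
    order of a triple; distinct fibres are disjoint.\<close>
  define F where "F S = {(x, y, z) \<in> P. {x, y, z} = S}" for S
  have fin: "finite P"
    by (rule finite_subset[of _ "V \<times> V \<times> V"]) (auto simp: P_def assms(1))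
  have finT: "finite T"
    by (rule finite_subset[of _ "Pow V"]) (auto simp: T_def triangle_sets_def assms(1))
  have finF: "finite (F S)" for S
    unfolding F_def by (rule finite_subset[OF _ fin]) auto
  have six: "6 \<le> card (F S)" if S: "S \<in> T" for S
  proof -
    obtain a b c where abc: "S = {a, b, c}" "a \<noteq> b" "b \<noteq> c" "a \<noteq> c"
      using S unfolding T_def triangle_sets_def card_3_iff by blast
    have "{(a, b, c), (a, c, b), (b, a, c), (b, c, a), (c, a, b), (c, b, a)} \<subseteq> F S"
      using S abc unfolding T_def triangle_sets_def F_def P_def by auto
    from card_mono[OF finF this] show ?thesis using abc by simp
  qed
  have "6 * card T \<le> (\<Sum>S\<in>T. card (F S))"
    using sum_mono[of T "\<lambda>_. 6" "\<lambda>S. card (F S)"] six by simp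
  also have "\<dots> = card (\<Union>S\<in>T. F S)"
    using finT finF by (subst card_UN_disjoint) (auto simp: F_def)
  also have "\<dots> \<le> card P"
    by (rule card_mono[OF fin]) (auto simp: F_def)
  finally have "6 * int (card T) \<le> int (card P)"
    by linarith
  also have "int (card P) = (\<Sum>(x, y, z)\<in>V \<times> V \<times> V. of_bool (R x y \<and> R y z \<and> R z x))"
  proof -
    have "P = (V \<times> V \<times> V) \<inter> {p. case p of (x, y, z) \<Rightarrow> R x y \<and> R y z \<and> R z x}"
      unfolding P_def by auto
    then show ?thesis
      using assms(1) by (simp add: case_prod_unfold)
  qed
  also have "\<dots> = (\<Sum>x\<in>V. \<Sum>y\<in>V. \<Sum>z\<in>V. of_bool (R x y \<and> R y z \<and> R z x))"
    by (simp add: sum.cartesian_product)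
  finally show ?thesis unfolding T_def .
qed

lemma goodman_inequality:
  assumes "finite V" and irrefl: "\<And>x. \<not> R x x" and sym: "\<And>x y. R x y \<Longrightarrow> R y x"
  shows "6 * int (card (triangle_sets R V))
      + 3 * (\<Sum>x\<in>V. int (card {y \<in> V. R x y}) * (int (card V) - 1 - int (card {y \<in> V. R x y})))
    \<le> int (card V) * (int (card V) - 1) * (int (card V) - 2)"
proof -
  define a :: "'a \<Rightarrow> 'a \<Rightarrow> int" where "a x y = of_bool (R x y)" for x y
  define b :: "'a \<Rightarrow> 'a \<Rightarrow> int" where "b x y = of_bool (x \<noteq> y \<and> \<not> R x y)" for x y
  \<comment> \<open>\<open>f\<close> marks an edge and a non-edge meeting at \<open>x\<close>. For
    fixed \<open>x\<close> its sum over \<open>y\<close> and \<open>z\<close> factors into the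
    number of neighbours times the number of non-neighbours of \<open>x\<close>.\<close>
  define f where "f x y z = a x y * b x z" for x y z
  have a_sum: "(\<Sum>y\<in>V. a x y) = int (card {y \<in> V. R x y})" for x
    using assms(1) by (simp add: a_def Int_def)
  have b_sum: "(\<Sum>y\<in>V. b x y) = int (card V) - 1 - int (card {y \<in> V. R x y})" if "x \<in> V" for x
  proof -
    have "V \<inter> {y. x \<noteq> y \<and> \<not> R x y} = V - insert x {y \<in> V. R x y}" by auto
    moreover have "card (insert x {y \<in> V. R x y}) \<le> card V"
      using that assms(1) by (intro card_mono) auto
    \<comment> \<open>By irreflexivity \<open>x\<close> is not among its own neighbours; this is the
      \<open>- 1\<close> in \<open>b_sum\<close>.\<close>
    moreover have "card (insert x {y \<in> V. R x y}) = Suc (card {y \<in> V. R x y})"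
      using assms(1) irrefl by simp
    ultimately show ?thesis
      using that assms(1) by (simp add: b_def card_Diff_subset of_nat_diff)
  qed
  have f_sum: "(\<Sum>x\<in>V. \<Sum>y\<in>V. \<Sum>z\<in>V. f x y z)
      = (\<Sum>x\<in>V. int (card {y \<in> V. R x y}) * (int (card V) - 1 - int (card {y \<in> V. R x y})))"
    unfolding f_def by (rule sum.cong) (simp_all add: a_sum b_sum flip: sum_product)
  \<comment> \<open>Any two of the four events disagree on whether some pair is an edge, so at most
    one holds. Each of them also forces the three points to be distinct.\<close>
  have point: "of_bool (R x y \<and> R y z \<and> R z x) + f x y z + f y z x + f z x y
      \<le> of_bool (x \<noteq> y \<and> y \<noteq> z \<and> x \<noteq> z)" for x y z
  proof -
    have "R y x = R x y" "R z y = R y z" "R x z = R z x"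
      using sym by blast+
    then show ?thesis
      using irrefl by (auto simp: f_def a_def b_def of_bool_def)
  qed
  have "(\<Sum>x\<in>V. \<Sum>y\<in>V. \<Sum>z\<in>V. of_bool (R x y \<and> R y z \<and> R z x) + f x y z + f y z x + f z x y)
      \<le> (\<Sum>x\<in>V. \<Sum>y\<in>V. \<Sum>z\<in>V. of_bool (x \<noteq> y \<and> y \<noteq> z \<and> x \<noteq> z))"
    by (intro sum_mono point)
  then have "(\<Sum>x\<in>V. \<Sum>y\<in>V. \<Sum>z\<in>V. of_bool (R x y \<and> R y z \<and> R z x))
      + 3 * (\<Sum>x\<in>V. \<Sum>y\<in>V. \<Sum>z\<in>V. f x y z)
      \<le> int (card V) * (int (card V) - 1) * (int (card V) - 2)"
    using sum_rotate[of f V] sum_rotate[of "\<lambda>x y z. f y z x" V]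
    by (simp only: sum.distrib sum_of_bool_distinct_triples[OF assms(1)])
  then show ?thesis
    using six_mult_card_triangle_sets_le[of V R] assms(1) irrefl unfolding f_sum by fastforce
qed

text \<open>Arcs leaving \<open>u\<close> with the same head would be parallel, so
  \<open>head G\<close> is injective on them. This turns the arc-based degree into the neighbour
  count of Goodman's inequality.\<close>

lemma (in nomulti_digraph) out_degree_eq_card_adj:
  "out_degree G u = card {w \<in> verts G. u \<rightarrow> w}"
proof -
  have "bij_betw (head G) (out_arcs G u) {w \<in> verts G. u \<rightarrow> w}"
    unfolding bij_betw_def
  proof
    show "inj_on (head G) (out_arcs G u)"
      by (auto intro!: inj_onI no_multi_arcs simp: arc_to_ends_def)
    show "head G ` out_arcs G u = {w \<in> verts G. u \<rightarrow> w}"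
      by (auto simp: arcs_ends_def arc_to_ends_def)
  qed
  then show ?thesis
    unfolding out_degree_def by (rule bij_betw_same_card)
qed

text \<open>
  Without multiple arcs, a complete subgraph is determined by its vertex set.
\<close>
lemma (in digraph) num_triangles_le_card_triangle_sets:
  "num_triangles G \<le> card (triangle_sets (\<lambda>u w. u \<rightarrow> w) (verts G))"
  unfolding num_triangles_def
proof (rule card_inj_on_le[where f = verts])
  show "inj_on verts {T. subgraph T G \<and> K\<^bsub>3\<^esub> T}"
  proof (rule inj_onI, clarify)
    fix S T :: "('a, 'b) pre_digraph"
    assume ST: "subgraph S G" "K\<^bsub>3\<^esub> S" "subgraph T G" "K\<^bsub>3\<^esub> T" "verts S = verts T"
    \<comment> \<open>Subgraphs inherit \<open>tail\<close> and \<open>head\<close>, hence also the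
      map \<open>arc_to_ends G\<close>, which is injective on arcs. Completeness fixes its image
      from the vertex set alone, and so fixes the arcs.\<close>
    have *: "arc_to_ends U = arc_to_ends G" "tail U = tail G" "head U = head G" "arcs U \<subseteq> arcs G"
      if "subgraph U G" for U :: "('a, 'b) pre_digraph"
      using that by (auto simp: subgraph_def compatible_def arc_to_ends_def fun_eq_iff)
    have "arcs_ends S = arcs_ends T"
      using ST by (simp add: complete_digraph_def)
    then have "arc_to_ends G ` arcs S = arc_to_ends G ` arcs T"
      using *[OF ST(1)] *[OF ST(3)] by (simp add: arcs_ends_def)
    then have "arcs S = arcs T"
      using inj_on_image_eq_iff[OF inj_on_arc_to_ends] *(4)[OF ST(1)] *(4)[OF ST(3)] by blast
    then show "S = T"
      using ST(5) *[OF ST(1)] *[OF ST(3)] by (intro pre_digraph.equality) auto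
  qed
  show "verts ` {T. subgraph T G \<and> K\<^bsub>3\<^esub> T} \<subseteq> triangle_sets (\<lambda>u w. u \<rightarrow> w) (verts G)"
  proof clarify
    fix T :: "('a, 'b) pre_digraph"
    assume "subgraph T G" "K\<^bsub>3\<^esub> T"
    then show "verts T \<in> triangle_sets (\<lambda>u w. u \<rightarrow> w) (verts G)"
      using subgraph_imp_subverts[of T G] arcs_ends_mono[of T G]
      by (auto simp: triangle_sets_def complete_digraph_def)
  qed
  show "finite (triangle_sets (\<lambda>u w. u \<rightarrow> w) (verts G))"
    unfolding triangle_sets_def by (rule finite_subset[of _ "Pow (verts G)"]) auto
qed

theorem theorem9:
  fixes k s :: int and H :: "('a, 'b) pre_digraph"
  assumes "even k"
    and "graph H"
    and "int (card (verts H)) = 2 * k - 1 - 2 * s"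
    and "\<exists>v \<in> verts H. int (out_degree H v) = k - 2 \<and>
           (\<forall>u \<in> verts H - {v}. int (out_degree H u) = k - 1)"
  shows "real (num_triangles H) \<le>
    1 / 6 * real_of_int ((2 * k - 1 - 2 * s) * ((k - 1) * (k - 2) - (k - 1 - 2 * s) * (2 * s + 1)))
      + 1 / 2 - real_of_int s"
proof -
  interpret graph H by fact
  define n where "n = 2 * k - 1 - 2 * s"
  obtain v where v: "v \<in> verts H" "int (out_degree H v) = k - 2"
    "\<And>u. u \<in> verts H - {v} \<Longrightarrow> int (out_degree H u) = k - 1"
    using assms(4) by blast
  have card: "int (card (verts H)) = n"
    using assms(3) by (simp add: n_def)
  \<comment> \<open>This keeps the natural-number subtraction in the size of
    \<open>verts H - {v}\<close> from truncating.\<close>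
  have "card (verts H) \<ge> 1"
    using v(1) card_gt_0_iff[of "verts H"] by auto
  then have card': "int (card (verts H - {v})) = n - 1"
    using v(1) card by (simp add: of_nat_diff)
  \<comment> \<open>The exceptional vertex \<open>v\<close> is split off: it has
    \<open>n - k + 1\<close> non-neighbours, every other vertex has \<open>n - k\<close>.\<close>
  have "(\<Sum>x\<in>verts H. int (out_degree H x) * (n - 1 - int (out_degree H x)))
      = (k - 2) * (n - 1 - (k - 2)) + (\<Sum>x\<in>verts H - {v}. (k - 1) * (n - 1 - (k - 1)))"
    using v by (subst sum.remove[of _ v]) (auto intro!: sum.cong)
  also have "\<dots> = (k - 2) * (n - k + 1) + (n - 1) * ((k - 1) * (n - k))"
    using card' by simp
  finally have degs: "(\<Sum>x\<in>verts H. int (out_degree H x) * (n - 1 - int (out_degree H x)))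
      = (k - 2) * (n - k + 1) + (n - 1) * ((k - 1) * (n - k))" .
  have "6 * int (card (triangle_sets (\<lambda>u w. u \<rightarrow>\<^bsub>H\<^esub> w) (verts H)))
      + 3 * (\<Sum>x\<in>verts H. int (out_degree H x) * (n - 1 - int (out_degree H x)))
      \<le> n * (n - 1) * (n - 2)"
    using goodman_inequality[of "verts H" "\<lambda>u w. u \<rightarrow>\<^bsub>H\<^esub> w",
        OF finite_verts adj_not_same[THEN notI] graph_symmetric]
    by (simp add: card out_degree_eq_card_adj)
  then have "6 * int (num_triangles H) + 3 * ((k - 2) * (n - k + 1) + (n - 1) * ((k - 1) * (n - k)))
      \<le> n * (n - 1) * (n - 2)"
    using num_triangles_le_card_triangle_sets unfolding degs by linarith
  \<comment> \<open>The right-hand side is an exact rewriting. If \<open>v\<close> also had degree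
    \<open>k - 1\<close>, only the product would remain; lowering its degree by one adds
    \<open>3 * (n - 2 * k + 2)\<close>, which is \<open>3 - 6 * s\<close>.\<close>
  then have "6 * int (num_triangles H)
      \<le> (2 * k - 1 - 2 * s) * ((k - 1) * (k - 2) - (k - 1 - 2 * s) * (2 * s + 1)) + 3 - 6 * s"
    by (simp add: n_def algebra_simps)
  then have "6 * real (num_triangles H) \<le> real_of_int
      ((2 * k - 1 - 2 * s) * ((k - 1) * (k - 2) - (k - 1 - 2 * s) * (2 * s + 1)) + 3 - 6 * s)"
    by (simp only: flip: of_int_le_iff[where 'a = real])
  then show ?thesis
    by simp
qed

end
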